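(* Let $G$ be a finite simple graph with $\Delta(G) \geq 3$. Then \[\chi(G) \leq \max \left\{\omega(G), \Delta_2(G), \frac{5}{6}(\Delta(G) + 1)\right\}.\]
   Context: $\chi(G)$ is the chromatic number, $\omega(G)$ the clique number and $\Delta(G)$ the maximum degree of $G$. $\Delta_2(G)$ (Stacho's parameter) is the largest degree that a vertex $v$ of $G$ can have subject to the condition that $v$ is adjacent to a vertex whose degree is at least as large as the degree of $v$; equivalently, $\Delta_2(G) = \min\{r \geq 0 : \text{the subgraph of } G \text{ induced on the vertices of degree at least } r \text{ is edgeless}\} - 1$. *)

theory Defs
  imports Complex_Main
begin

definition simple_graph :: "'a set \<Rightarrow> ('a \<Rightarrow> 'a \<Rightarrow> bool) \<Rightarrow> bool" where
  "simple_graph V E \<longleftrightarrow> finite V \<and> (\<forall>u v. E u v \<longrightarrow> u \<in> V \<and> v \<in> V)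
     \<and> (\<forall>u v. E u v \<longrightarrow> E v u) \<and> (\<forall>v. \<not> E v v)"

definition degree :: "'a set \<Rightarrow> ('a \<Rightarrow> 'a \<Rightarrow> bool) \<Rightarrow> 'a \<Rightarrow> nat" where
  "degree V E v = card {u \<in> V. E v u}"

definition max_degree :: "'a set \<Rightarrow> ('a \<Rightarrow> 'a \<Rightarrow> bool) \<Rightarrow> nat" where
  "max_degree V E = Max (insert 0 (degree V E ` V))"

text \<open>Stacho's parameter: the largest degree of a vertex v adjacent to a vertex
whose degree is at least the degree of v.\<close>
definition delta2 :: "'a set \<Rightarrow> ('a \<Rightarrow> 'a \<Rightarrow> bool) \<Rightarrow> nat" where
  "delta2 V E = Max (insert 0 {degree V E v | v. v \<in> V \<and>
       (\<exists>w \<in> V. E v w \<and> degree V E w \<ge> degree V E v)})"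

definition is_clique :: "'a set \<Rightarrow> ('a \<Rightarrow> 'a \<Rightarrow> bool) \<Rightarrow> 'a set \<Rightarrow> bool" where
  "is_clique V E K \<longleftrightarrow> K \<subseteq> V \<and> (\<forall>u \<in> K. \<forall>v \<in> K. u \<noteq> v \<longrightarrow> E u v)"

definition clique_number :: "'a set \<Rightarrow> ('a \<Rightarrow> 'a \<Rightarrow> bool) \<Rightarrow> nat" where
  "clique_number V E = Max {card K | K. is_clique V E K}"

definition proper_colouring :: "'a set \<Rightarrow> ('a \<Rightarrow> 'a \<Rightarrow> bool) \<Rightarrow> nat \<Rightarrow> ('a \<Rightarrow> nat) \<Rightarrow> bool" where
  "proper_colouring V E k c \<longleftrightarrow> (\<forall>v \<in> V. c v < k) \<and> (\<forall>u \<in> V. \<forall>v \<in> V. E u v \<longrightarrow> c u \<noteq> c v)"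

definition chromatic_number :: "'a set \<Rightarrow> ('a \<Rightarrow> 'a \<Rightarrow> bool) \<Rightarrow> nat" where
  "chromatic_number V E = (LEAST k. \<exists>c. proper_colouring V E k c)"

end

theory Submission
  imports Defs
begin

text \<open>Let \<open>t + 1\<close> be the chromatic number and suppose it exceeds the maximum. In a vertex-critical
subgraph the high vertices (degree above \<open>t\<close>) are independent because of \<open>\<Delta>\<^sub>2\<close>. Following Lovasz,
partition the vertices into \<open>s\<close> parts with capacities \<open>r i\<close> summing to \<open>t\<close> such that, after removal
of one vertex (the token), part \<open>i\<close> is \<open>r i\<close>-colourable, and minimise the edges inside parts.
Then the component of the token in its part \<open>i\<close> is \<open>r i\<close>-regular, every vertex of it can serve as
the token, and a low token can be moved to any other part. Moving it back and forth between two
parts for ever, always leaving a component through a vertex other than the one that entered it, is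
impossible, as the components left behind cannot be entered again. Hence it must return to the
component it started from, which makes adjacent low vertices twins. The closed neighbourhood of a
low token is then a clique with \<open>t + 1\<close> vertices up to missing edges between high vertices; if it
misses one, two of its high vertices can share a colour, and the graph is \<open>t\<close>-colourable.\<close>

section \<open>Colourings and their extension\<close>

definition colourable :: "('a \<Rightarrow> 'a \<Rightarrow> bool) \<Rightarrow> 'a set \<Rightarrow> nat \<Rightarrow> bool" where
  "colourable E X n \<longleftrightarrow> (\<exists>c. proper_colouring X E n c)"

lemma colourableI:
  assumes "finite C" "card C \<le> n" "\<And>v. v \<in> X \<Longrightarrow> c v \<in> C"
    and "\<And>u v. u \<in> X \<Longrightarrow> v \<in> X \<Longrightarrow> E u v \<Longrightarrow> c u \<noteq> c v"
  shows "colourable E X n"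
proof -
  obtain h where h: "bij_betw h C {0..<card C}"
    using ex_bij_betw_finite_nat[OF assms(1)] by blast
  have "h (c v) < n" if "v \<in> X" for v
    using bij_betwE[OF h] assms(2,3) that by fastforce
  moreover have "h (c u) \<noteq> h (c v)" if "u \<in> X" "v \<in> X" "E u v" for u v
    using h assms(3,4) that unfolding bij_betw_def inj_on_def by metis
  ultimately show ?thesis
    unfolding colourable_def proper_colouring_def by (intro exI[of _ "\<lambda>v. h (c v)"]) auto
qed

lemma colourable_mono:
  "colourable E X n \<Longrightarrow> Y \<subseteq> X \<Longrightarrow> colourable E Y n"
  unfolding colourable_def proper_colouring_def by blast

locale graph =
  fixes V :: "'a set" and E :: "'a \<Rightarrow> 'a \<Rightarrow> bool"
  assumes simple: "simple_graph V E"
begin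

lemma finite_V: "finite V"
  and edge_in: "E u v \<Longrightarrow> u \<in> V \<and> v \<in> V"
  and edge_sym: "E u v \<Longrightarrow> E v u"
  and edge_irrefl: "\<not> E v v"
  using simple unfolding simple_graph_def by auto

definition nb :: "'a \<Rightarrow> 'a set" where
  "nb v = {u. E v u}"

lemma finite_adjacent: "finite {u. E v u \<and> Q u}"
  by (rule finite_subset[OF _ finite_V]) (use edge_in in blast)

lemma nb_subset: "nb v \<subseteq> V"
  using edge_in by (auto simp: nb_def)

lemma finite_nb: "finite (nb v)"
  using nb_subset finite_V finite_subset by blast

lemma colour_missing:
  assumes "proper_colouring (X - {x}) E n c" "a < n" "\<And>u. u \<in> X \<Longrightarrow> E x u \<Longrightarrow> c u \<noteq> a"
  shows "colourable E X n"
proof -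
  have "proper_colouring X E n (c(x := a))"
    using assms edge_sym edge_irrefl unfolding proper_colouring_def
    by (auto simp: fun_upd_def)
  then show ?thesis
    unfolding colourable_def by blast
qed

lemma colourable_extend:
  assumes "colourable E (X - {x}) n" "card {u. E x u \<and> u \<in> X} < n"
  shows "colourable E X n"
proof -
  obtain c where c: "proper_colouring (X - {x}) E n c"
    using assms(1) colourable_def by blast
  have "card (c ` {u. E x u \<and> u \<in> X}) < n"
    using card_image_le[OF finite_adjacent, of c] assms(2) by (meson le_less_trans)
  then have "\<not> {..<n} \<subseteq> c ` {u. E x u \<and> u \<in> X}"
    by (metis card_lessThan card_mono finite_imageI finite_adjacent not_le)
  then obtain a where "a < n" "a \<notin> c ` {u. E x u \<and> u \<in> X}"
    by blast
  then show ?thesis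
    using colour_missing[OF c] by blast
qed

text \<open>The vertices of \<^term>\<open>Hs\<close> have so long lists of admissible colours that two of them
can share a colour; this saves a colour on the clique-like set \<^term>\<open>K\<close>.\<close>

lemma colourable_merge:
  assumes X: "finite X" and K: "K \<subseteq> X" "card K = n + 1" and Hs: "Hs \<subseteq> K"
    and indep: "\<And>x y. x \<in> Hs \<Longrightarrow> y \<in> Hs \<Longrightarrow> \<not> E x y"
    and inside: "\<And>w v. w \<in> K - Hs \<Longrightarrow> v \<in> X \<Longrightarrow> E w v \<Longrightarrow> v \<in> K"
    and few: "\<And>x. x \<in> Hs \<Longrightarrow> card {v. E x v \<and> v \<in> X - K} \<le> m"
    and big: "n < card Hs * (n - m)"
    and col: "colourable E (X - K) n"
  shows "colourable E X n"
proof -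
  obtain c where c: "\<And>v. v \<in> X - K \<Longrightarrow> c v < n"
    "\<And>u v. u \<in> X - K \<Longrightarrow> v \<in> X - K \<Longrightarrow> E u v \<Longrightarrow> c u \<noteq> c v"
    using col unfolding colourable_def proper_colouring_def by blast
  define L where "L x = {..<n} - c ` {v. E x v \<and> v \<in> X - K}" for x
  have finK: "finite K" using X K finite_subset by blast
  have finH: "finite Hs" using finK Hs finite_subset by blast
  have L: "n - m \<le> card (L x)" if "x \<in> Hs" for x
  proof -
    have "card (c ` {v. E x v \<and> v \<in> X - K}) \<le> m"
      by (rule le_trans[OF card_image_le[OF finite_adjacent] few[OF that]])
    then have "n - m \<le> card {..<n} - card (c ` {v. E x v \<and> v \<in> X - K})" by simp
    also have "\<dots> \<le> card (L x)"
      unfolding L_def by (rule diff_card_le_card_Diff) (simp add: finite_adjacent)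
    finally show ?thesis .
  qed
  \<comment> \<open>Pairwise disjoint lists would contain at least \<open>card Hs * (n - m)\<close>,
    hence more than \<open>n\<close>, colours.\<close>
  have "\<exists>x\<in>Hs. \<exists>y\<in>Hs. x \<noteq> y \<and> L x \<inter> L y \<noteq> {}"
  proof (rule ccontr)
    assume "\<not> ?thesis"
    then have "card (\<Union>x\<in>Hs. L x) = (\<Sum>x\<in>Hs. card (L x))"
      by (intro card_UN_disjoint finH) (auto simp: L_def)
    also have "\<dots> \<ge> card Hs * (n - m)"
      using sum_mono[of Hs "\<lambda>_. n - m" "\<lambda>x. card (L x)"] L by simp
    finally have "n < card (\<Union>x\<in>Hs. L x)" using big by linarith
    moreover have "card (\<Union>x\<in>Hs. L x) \<le> card {..<n}"
      by (rule card_mono) (auto simp: L_def)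
    ultimately show False by simp
  qed
  then obtain x y a where xy: "x \<in> Hs" "y \<in> Hs" "x \<noteq> y" and a: "a \<in> L x" "a \<in> L y"
    by blast
  have ne: "L z \<noteq> {}" if "z \<in> Hs" for z
    using L[OF that] big by (cases "n - m") auto
  \<comment> \<open>As \<open>x\<close> and \<open>y\<close> share \<open>a\<close>,
    \<open>g\<close> uses fewer than \<open>card Hs\<close> colours on \<open>Hs\<close>; enough
    remain to give the other \<open>n + 1 - card Hs\<close> vertices of \<open>K\<close> distinct
    colours.\<close>
  define g where "g z = (if z = x \<or> z = y then a else SOME b. b \<in> L z)" for z
  have g: "g z \<in> L z" if "z \<in> Hs" for z
    using ne[OF that] a some_in_eq[of "L z"] by (auto simp: g_def)
  have "g ` Hs = g ` (Hs - {y})"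
    using xy by (auto simp: g_def)
  then have cg: "card (g ` Hs) < card Hs"
    by (metis card_Diff1_less card_image_le finH finite_Diff le_less_trans xy(2))
  have "card (K - Hs) = n + 1 - card Hs"
    using K Hs finH by (simp add: card_Diff_subset)
  also have "\<dots> \<le> n - card (g ` Hs)" using cg by linarith
  also have "\<dots> \<le> card ({..<n} - g ` Hs)"
    using diff_card_le_card_Diff[of "g ` Hs" "{..<n}"] finH by simp
  finally obtain h where h: "inj_on h (K - Hs)" "h ` (K - Hs) \<subseteq> {..<n} - g ` Hs"
    using card_le_inj[of "K - Hs" "{..<n} - g ` Hs"] finK by auto
  define d where "d v = (if v \<in> Hs then g v else if v \<in> K then h v else c v)" for v
  have dn: "d v < n" if "v \<in> X" for v
    using that h(2) g[of v] c(1)[of v] by (auto simp: d_def L_def)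
  have dd: "d u \<noteq> d v" if uv: "u \<in> X" "v \<in> X" "E u v" and o: "u \<in> Hs \<or> (u \<in> K - Hs \<and> v \<notin> Hs) \<or> (u \<notin> K \<and> v \<notin> K)" for u v
    using o
  proof (elim disjE)
    assume u: "u \<in> Hs"
    then have "v \<notin> Hs" using indep uv by blast
    then show ?thesis using u uv h(2) g[OF u] by (auto simp: d_def L_def)
  next
    assume u: "u \<in> K - Hs \<and> v \<notin> Hs"
    then have "v \<in> K - Hs" "u \<noteq> v" using inside uv edge_irrefl by blast+
    then show ?thesis using u h(1) by (auto simp: d_def inj_on_def)
  next
    assume "u \<notin> K \<and> v \<notin> K"
    then show ?thesis using c(2) uv Hs by (auto simp: d_def)
  qed
  have "d u \<noteq> d v" if "u \<in> X" "v \<in> X" "E u v" for u v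
  proof -
    have "u \<in> K - Hs \<Longrightarrow> v \<in> K" "v \<in> K - Hs \<Longrightarrow> u \<in> K"
      using inside that edge_sym by blast+
    then show ?thesis
      using dd[of u v] dd[of v u] that edge_sym[of u v] Hs by (metis DiffI subsetD)
  qed
  with dn show ?thesis
    unfolding colourable_def proper_colouring_def by blast
qed

section \<open>Connected components within a vertex set\<close>

definition component :: "'a set \<Rightarrow> 'a \<Rightarrow> 'a set" where
  "component X x = {y. (x, y) \<in> {(u, v). u \<in> X \<and> v \<in> X \<and> E u v}\<^sup>*}"

lemma component_refl [simp]: "x \<in> component X x"
  by (simp add: component_def)

lemma component_step: "y \<in> component X x \<Longrightarrow> y \<in> X \<Longrightarrow> z \<in> X \<Longrightarrow> E y z \<Longrightarrow> z \<in> component X x"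
  unfolding component_def by (auto intro: rtrancl_into_rtrancl)

lemma component_trans: "y \<in> component X x \<Longrightarrow> z \<in> component X y \<Longrightarrow> z \<in> component X x"
  unfolding component_def by auto

lemma component_sym: "y \<in> component X x \<Longrightarrow> x \<in> component X y"
proof -
  have "sym ({(u, v). u \<in> X \<and> v \<in> X \<and> E u v}\<^sup>*)"
    by (rule sym_rtrancl) (auto simp: sym_def edge_sym)
  then show "y \<in> component X x \<Longrightarrow> x \<in> component X y"
    unfolding component_def sym_def by blast
qed

lemma component_mono: "X \<subseteq> Y \<Longrightarrow> component X x \<subseteq> component Y x"
  unfolding component_def by (auto elim!: rtrancl_mono[THEN subsetD, rotated])

lemma component_induct [consumes 1, case_names base step]:
  assumes "y \<in> component X x" "P x"
    and "\<And>y z. y \<in> component X x \<Longrightarrow> P y \<Longrightarrow> y \<in> X \<Longrightarrow> z \<in> X \<Longrightarrow> E y z \<Longrightarrow> P z"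
  shows "P y"
proof -
  have "(x, y) \<in> {(u, v). u \<in> X \<and> v \<in> X \<and> E u v}\<^sup>*"
    using assms(1) by (simp add: component_def)
  then show ?thesis
    by (induction rule: rtrancl_induct) (use assms(2,3) in \<open>auto simp: component_def\<close>)
qed

lemma component_subset: "x \<in> X \<Longrightarrow> component X x \<subseteq> X"
proof
  fix y assume "y \<in> component X x" "x \<in> X"
  then show "y \<in> X" by (induction rule: component_induct) auto
qed

end


section \<open>Distributing the colours among parts\<close>

lemma colourable_parts:
  fixes E :: "'a \<Rightarrow> 'a \<Rightarrow> bool" and P :: "'a \<Rightarrow> nat"
  assumes "\<And>v. v \<in> X \<Longrightarrow> P v < s"
    and "\<And>i. i < s \<Longrightarrow> colourable E {v \<in> X. P v = i} (r i)"
  shows "colourable E X (\<Sum>i<s. r i)"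
proof -
  from assms(2) obtain c where c: "\<And>i. i < s \<Longrightarrow> proper_colouring {v \<in> X. P v = i} E (r i) (c i)"
    unfolding colourable_def by metis
  show ?thesis
  proof (rule colourableI[where C = "SIGMA i:{..<s}. {..<r i}" and c = "\<lambda>v. (P v, c (P v) v)"])
    show "(P v, c (P v) v) \<in> (SIGMA i:{..<s}. {..<r i})" if "v \<in> X" for v
      using c[OF assms(1)[OF that]] assms(1)[OF that] that by (auto simp: proper_colouring_def)
    show "(P u, c (P u) u) \<noteq> (P v, c (P v) v)" if "u \<in> X" "v \<in> X" "E u v" for u v
      using c[OF assms(1)[OF that(1)]] that by (auto simp: proper_colouring_def)
  qed auto
qed

text \<open>Splits \<open>t\<close> colours into blocks of sizes \<open>r i\<close>, which turns a
  \<open>t\<close>-colouring into a partition with these capacities.\<close>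

lemma ex_fibres:
  fixes r :: "nat \<Rightarrow> nat"
  shows "\<exists>g. (\<forall>c < (\<Sum>i<s. r i). g c < s) \<and> (\<forall>i<s. card {c. c < (\<Sum>i<s. r i) \<and> g c = i} = r i)"
proof (induction s)
  case (Suc s)
  let ?S = "\<Sum>i<s. r i"
  obtain g where g: "\<And>c. c < ?S \<Longrightarrow> g c < s" "\<And>i. i < s \<Longrightarrow> card {c. c < ?S \<and> g c = i} = r i"
    using Suc.IH by auto
  define h where "h c = (if c < ?S then g c else s)" for c
  have "{c. c < ?S + r s \<and> h c = i} = (if i < s then {c. c < ?S \<and> g c = i} else {?S..<?S + r s})"
    if "i < Suc s" for i
  proof (cases "i < s")
    case False
    then have "i = s" using that by simp
    have *: "h c = s \<longleftrightarrow> ?S \<le> c" for c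
      using g(1)[of c] by (auto simp: h_def)
    have "{c. c < ?S + r s \<and> h c = s} = {?S..<?S + r s}"
      unfolding * by auto
    then show ?thesis by (simp add: \<open>i = s\<close>)
  qed (auto simp: h_def)
  then have "card {c. c < ?S + r s \<and> h c = i} = r i" if "i < Suc s" for i
    using that g(2) by (auto simp: less_Suc_eq)
  moreover have "h c < Suc s" for c
    using g(1)[of c] by (auto simp: h_def)
  ultimately show ?case by auto
qed auto

section \<open>Partitions of minimal weight and the token\<close>

text \<open>By \<open>nb_bound\<close> degrees stay below the sum of all \<open>r i + 1\<close>, so
  every vertex has at most \<open>r j\<close> neighbours in some part \<open>j\<close>. Only part
  \<open>0\<close> may have capacity 1, and only if no vertex is high.\<close>

locale critical_graph = graph V E
  for V :: "'a set" and E :: "'a \<Rightarrow> 'a \<Rightarrow> bool" +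
  fixes t s :: nat and r :: "nat \<Rightarrow> nat"
  assumes not_colourable: "\<not> colourable E V t"
    and critical: "v \<in> V \<Longrightarrow> colourable E (V - {v}) t"
    and sum_r: "(\<Sum>i<s. r i) = t"
    and two_parts: "2 \<le> s"
    and r_0: "1 \<le> r 0"
    and r_pos: "0 < i \<Longrightarrow> i < s \<Longrightarrow> 2 \<le> r i"
    and high_r_0: "t < card (nb v) \<Longrightarrow> 2 \<le> r 0"
    and high_indep: "E u v \<Longrightarrow> card (nb u) \<le> t \<or> card (nb v) \<le> t"
    and nb_bound: "card (nb v) < t + s"
begin

definition low :: "'a \<Rightarrow> bool" where
  "low v \<longleftrightarrow> card (nb v) \<le> t"

definition part :: "('a \<Rightarrow> nat) \<Rightarrow> nat \<Rightarrow> 'a set" where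
  "part P i = {v \<in> V. P v = i}"

definition N :: "('a \<Rightarrow> nat) \<Rightarrow> nat \<Rightarrow> 'a \<Rightarrow> 'a set" where
  "N P i v = {u. E v u \<and> P u = i}"

text \<open>A vertex \<^term>\<open>x\<close> whose removal leaves every part \<^term>\<open>i\<close> with a colouring by
\<^term>\<open>r i\<close> colours: it acts as a token, and a low token can be moved to any part.\<close>

definition valid :: "('a \<Rightarrow> nat) \<Rightarrow> 'a \<Rightarrow> bool" where
  "valid P x \<longleftrightarrow> x \<in> V \<and> (\<forall>v\<in>V. P v < s) \<and> (\<forall>i<s. colourable E (part P i - {x}) (r i))"

text \<open>Up to an additive constant this is twice the number of edges inside parts minus twice the
sum of all \<^term>\<open>r (P v)\<close>.\<close>

definition weight :: "('a \<Rightarrow> nat) \<Rightarrow> nat" where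
  "weight P = card {(u, v). E u v \<and> P u = P v} + 2 * (\<Sum>v\<in>V. t - r (P v))"

text \<open>\<open>weight\<close> ignores the token, so passing the token on without changing
  \<open>P\<close> preserves minimality.\<close>

definition state :: "('a \<Rightarrow> nat) \<Rightarrow> 'a \<Rightarrow> bool" where
  "state P x \<longleftrightarrow> valid P x \<and> (\<forall>P' x'. valid P' x' \<longrightarrow> weight P \<le> weight P')"

lemma finite_N: "finite (N P i v)"
  by (simp add: N_def finite_adjacent)

lemma N_part: "N P i v \<subseteq> part P i"
  using edge_in by (auto simp: N_def part_def)

lemma N_upd: "N (P(x := j)) i x = N P i x"
  using edge_irrefl by (auto simp: N_def)

lemma part_upd_diff: "part (P(x := j)) i - {x} = part P i - {x}"
  by (auto simp: part_def)

lemma valid_upd: "valid P x \<Longrightarrow> j < s \<Longrightarrow> valid (P(x := j)) x"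
  using part_upd_diff unfolding valid_def by auto

text \<open>Makes the truncated subtraction in \<open>weight\<close> exact.\<close>

lemma r_le_t: "i < s \<Longrightarrow> r i \<le> t"
  using member_le_sum[of i "{..<s}" r] sum_r by auto

text \<open>Delete any vertex, colour the rest by criticality and group the colours into blocks. The
  deleted vertex is the token; its own part is arbitrary.\<close>

lemma ex_valid: "\<exists>P x. valid P x"
proof -
  have "V \<noteq> {}"
  proof
    assume "V = {}"
    then have "colourable E V t" by (simp add: colourable_def proper_colouring_def)
    then show False using not_colourable by blast
  qed
  then obtain x where x: "x \<in> V" by blast
  obtain c where c: "proper_colouring (V - {x}) E t c"
    using critical[OF x] colourable_def by blast
  obtain g where g: "\<And>c. c < t \<Longrightarrow> g c < s" "\<And>i. i < s \<Longrightarrow> card {c. c < t \<and> g c = i} = r i"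
    using ex_fibres[where s = s and r = r] sum_r by auto
  define P where "P v = (if v = x then 0 else g (c v))" for v
  have "colourable E (part P i - {x}) (r i)" if "i < s" for i
    using c g(2)[OF that]
    by (intro colourableI[where C = "{c. c < t \<and> g c = i}" and c = c])
      (auto simp: part_def P_def proper_colouring_def)
  moreover have "P v < s" if "v \<in> V" for v
    using c g(1) that two_parts by (auto simp: P_def proper_colouring_def)
  ultimately show ?thesis using x unfolding valid_def by blast
qed

lemma ex_state: "\<exists>P x. state P x"
proof -
  obtain P0 x0 where "valid P0 x0" using ex_valid by blast
  then have "\<exists>P. (\<exists>x. valid P x) \<and> (\<forall>P'. (\<exists>x. valid P' x) \<longrightarrow> weight P \<le> weight P')"
    using ex_has_least_nat[of "\<lambda>P. \<exists>x. valid P x" P0 weight] by blast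
  then show ?thesis unfolding state_def by blast
qed

text \<open>The other parts fit their capacities, so a colouring of this one would complete a
  \<open>t\<close>-colouring of the graph.\<close>

lemma valid_part_not_colourable:
  assumes "valid P x"
  shows "\<not> colourable E (part P (P x)) (r (P x))"
proof
  assume *: "colourable E (part P (P x)) (r (P x))"
  have "colourable E (part P i) (r i)" if "i < s" for i
  proof (cases "i = P x")
    case False
    then have "part P i - {x} = part P i" by (auto simp: part_def)
    then show ?thesis using assms that unfolding valid_def by metis
  qed (use * in simp)
  then have "colourable E V t"
    using colourable_parts[where X = V and P = P and s = s and E = E and r = r] assms sum_r
    unfolding valid_def part_def by auto
  then show False using not_colourable by blast
qed

text \<open>With fewer neighbours in part \<open>j\<close>, the token could move there and be
  coloured greedily.\<close>

lemma valid_card_N: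
  assumes "valid P x" "j < s"
  shows "r j \<le> card (N P j x)"
proof (rule ccontr)
  assume *: "\<not> ?thesis"
  let ?P = "P(x := j)"
  have v: "valid ?P x" using valid_upd assms by blast
  have "{u. E x u \<and> u \<in> part ?P j} = N P j x"
    using edge_irrefl edge_in by (auto simp: N_def part_def)
  moreover have "colourable E (part ?P j - {x}) (r j)"
    using v assms(2) unfolding valid_def by blast
  ultimately have "colourable E (part ?P j) (r j)"
    using * by (auto intro: colourable_extend[of "part ?P j" x "r j"])
  then show False using valid_part_not_colourable[OF v] by simp
qed

text \<open>Only pairs containing \<open>x\<close> change, and each edge counts as two ordered
  pairs. The identity is additive to avoid subtraction of naturals.\<close>

lemma weight_upd:
  assumes "x \<in> V" "j < s" "P x < s"
  shows "weight (P(x := j)) + 2 * card (N P (P x) x) + 2 * r j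
    = weight P + 2 * card (N P j x) + 2 * r (P x)"
proof -
  define B where "B = {(u, v). E u v \<and> P u = P v \<and> u \<noteq> x \<and> v \<noteq> x}"
  define S where "S = (\<Sum>v\<in>V - {x}. t - r (P v))"
  have fE: "finite B" 
  proof (rule finite_subset)
    show "B \<subseteq> V \<times> V" using edge_in by (auto simp: B_def)
  qed (simp add: finite_V)
  have *: "weight Q = card B + 2 * card (N Q (Q x) x) + 2 * S + 2 * (t - r (Q x))"
    if "\<And>v. v \<noteq> x \<Longrightarrow> Q v = P v" for Q
  proof -
    have eq: "{(u, v). E u v \<and> Q u = Q v} = B \<union> ({x} \<times> N Q (Q x) x \<union> N Q (Q x) x \<times> {x})"
      using that edge_sym edge_irrefl by (auto simp: B_def N_def) metis+
    have "card {(u, v). E u v \<and> Q u = Q v}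
      = card B + card ({x} \<times> N Q (Q x) x \<union> N Q (Q x) x \<times> {x})"
      unfolding eq
      by (rule card_Un_disjoint) (use fE finite_N[of Q "Q x" x] in \<open>simp_all\<close>, auto simp: B_def)
    also have "card ({x} \<times> N Q (Q x) x \<union> N Q (Q x) x \<times> {x})
      = card ({x} \<times> N Q (Q x) x) + card (N Q (Q x) x \<times> {x})"
      by (rule card_Un_disjoint) (use finite_N[of Q "Q x" x] edge_irrefl in \<open>auto simp: N_def\<close>)
    finally have 1: "card {(u, v). E u v \<and> Q u = Q v} = card B + 2 * card (N Q (Q x) x)"
      by (simp add: card_cartesian_product)
    have "(\<Sum>v\<in>V. t - r (Q v)) = (t - r (Q x)) + (\<Sum>v\<in>V - {x}. t - r (Q v))"
      by (rule sum.remove[OF finite_V assms(1)])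
    also have "(\<Sum>v\<in>V - {x}. t - r (Q v)) = S"
      unfolding S_def by (rule sum.cong) (auto simp: that)
    finally show ?thesis
      unfolding weight_def 1 by simp
  qed
  show ?thesis
    using *[of P] *[of "P(x := j)"] r_le_t[OF assms(2)] r_le_t[OF assms(3)]
    by (simp add: N_upd)
qed

lemma state_valid: "state P x \<Longrightarrow> valid P x"
  by (simp add: state_def)

lemma state_in: "state P x \<Longrightarrow> x \<in> V" "state P x \<Longrightarrow> P x < s"
  by (auto simp: state_def valid_def)

lemma sum_card_N:
  assumes "\<forall>v\<in>V. P v < s"
  shows "(\<Sum>i<s. card (N P i x)) = card (nb x)"
proof -
  have "nb x = (\<Union>i<s. N P i x)"
    using assms edge_in by (auto simp: nb_def N_def)
  then show ?thesis
    by (subst card_UN_disjoint[symmetric]) (auto simp: finite_adjacent N_def)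
qed

text \<open>Otherwise the token has too many neighbours in its part, \<open>nb_bound\<close> gives a
  part \<open>j\<close> with at most \<open>r j\<close> of them, and moving there lowers the
  weight.\<close>

lemma state_card_N:
  assumes st: "state P x"
  shows "card (N P (P x) x) = r (P x)"
proof (rule ccontr)
  assume "\<not> ?thesis"
  then have gt: "r (P x) < card (N P (P x) x)"
    using valid_card_N[OF state_valid[OF st] state_in(2)[OF st]] by linarith
  have "\<exists>j<s. card (N P j x) \<le> r j"
  proof (rule ccontr)
    assume "\<not> ?thesis"
    then have "(\<Sum>i<s. r i + 1) \<le> (\<Sum>i<s. card (N P i x))"
      by (intro sum_mono) (simp add: not_le Suc_leI)
    moreover have "(\<Sum>i<s. r i + 1) = t + s"
      using sum_r by (simp only: sum.distrib) simp
    ultimately have "t + s \<le> card (nb x)"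
      using sum_card_N[of P x] st by (simp add: state_def valid_def)
    then show False using nb_bound[of x] by simp
  qed
  then obtain j where j: "j < s" "card (N P j x) \<le> r j" by blast
  then have "weight (P(x := j)) < weight P"
    using weight_upd[of x j P, OF state_in(1)[OF st] j(1) state_in(2)[OF st]] gt by linarith
  moreover have "weight P \<le> weight (P(x := j))"
    using st valid_upd[OF state_valid[OF st] j(1)] unfolding state_def by blast
  ultimately show False by simp
qed

text \<open>The degree is at most the sum of the capacities, so all lower bounds of
  \<open>valid_card_N\<close> are equalities.\<close>

lemma low_card_N:
  assumes st: "state P x" and "low x" "j < s"
  shows "card (N P j x) = r j"
proof (rule ccontr)
  assume "\<not> ?thesis"
  have ge: "\<forall>i\<in>{..<s}. r i \<le> card (N P i x)"
    using valid_card_N[OF state_valid[OF st]] by simp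
  then have "r j \<le> card (N P j x)"
    using \<open>j < s\<close> by simp
  with \<open>\<not> ?thesis\<close> have "r j < card (N P j x)"
    by linarith
  then have "(\<Sum>i<s. r i) < (\<Sum>i<s. card (N P i x))"
    using \<open>j < s\<close> by (intro sum_strict_mono_ex1[OF _ ge]) auto
  moreover have "\<forall>v\<in>V. P v < s"
    using st by (simp add: state_def valid_def)
  ultimately show False
    using sum_card_N[of P x] sum_r \<open>low x\<close> by (simp add: low_def)
qed

lemma state_move:
  assumes st: "state P x" and "low x" "j < s"
  shows "state (P(x := j)) x"
proof -
  have "weight (P(x := j)) = weight P"
    using weight_upd[of x j P, OF state_in(1)[OF st] assms(3) state_in(2)[OF st]]
      low_card_N[OF assms] state_card_N[OF st] by simp
  then show ?thesis
    using st valid_upd[OF _ assms(3)] unfolding state_def by simp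
qed

text \<open>The neighbours of \<open>x\<close> in its part show all \<open>r (P x)\<close> colours
  and are equally many, so only \<open>y\<close> among them has its colour. Hence \<open>x\<close>
  can take that colour once \<open>y\<close> is the token.\<close>

lemma state_shift:
  assumes st: "state P x" and y: "y \<in> N P (P x) x"
  shows "state P y"
proof -
  let ?X = "part P (P x)" and ?n = "r (P x)"
  have xV: "x \<in> V" and Px: "P x < s" using state_in[OF st] by auto
  have Exy: "E x y" and Py: "P y = P x" using y by (auto simp: N_def)
  then have yV: "y \<in> V" using edge_in by blast
  obtain c where c: "proper_colouring (?X - {x}) E ?n c"
    using st Px by (auto simp: state_def valid_def colourable_def)
  have "{..<?n} \<subseteq> c ` N P (P x) x"
  proof
    fix a assume "a \<in> {..<?n}"
    then show "a \<in> c ` N P (P x) x"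
      using colour_missing[OF c, of a] valid_part_not_colourable[OF state_valid[OF st]]
      by (force simp: N_def part_def)
  qed
  then have "?n \<le> card (c ` N P (P x) x)"
    using card_mono[OF finite_imageI[OF finite_N]] by fastforce
  then have inj: "inj_on c (N P (P x) x)"
    using state_card_N[OF st] by (intro eq_card_imp_inj_on finite_N le_antisym card_image_le) auto
  have "c y \<noteq> c w" if "w \<in> ?X" "E x w" "w \<noteq> y" for w
    using inj y that by (auto simp: inj_on_def N_def part_def)
  note new = this
  have "proper_colouring (?X - {y}) E ?n (c(x := c y))"
    unfolding proper_colouring_def
  proof (intro conjI ballI impI)
    fix v assume "v \<in> ?X - {y}"
    moreover have "y \<in> ?X - {x}" using yV Py Exy edge_irrefl by (auto simp: part_def)
    ultimately show "(c(x := c y)) v < ?n" using c by (auto simp: proper_colouring_def)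
  next
    fix u v assume uv: "u \<in> ?X - {y}" "v \<in> ?X - {y}" "E u v"
    then have "u \<noteq> v" using edge_irrefl by blast
    then show "(c(x := c y)) u \<noteq> (c(x := c y)) v"
      using uv c new[of u] new[of v] edge_sym[of u v]
      by (cases "u = x"; cases "v = x") (auto simp: proper_colouring_def)
  qed
  then have py: "colourable E (?X - {y}) ?n"
    unfolding colourable_def by blast
  have "colourable E (part P i - {y}) (r i)" if "i < s" for i
  proof (cases "i = P x")
    case False
    then have "part P i - {y} = part P i - {x}" using Py by (auto simp: part_def)
    then show ?thesis using st that by (simp add: state_def valid_def)
  qed (use py in simp)
  then show ?thesis
    using st yV by (auto simp: state_def valid_def)
qed

section \<open>The component of the token\<close>

lemma part_mem: "state P x \<Longrightarrow> x \<in> part P (P x)"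
  using state_in(1) by (simp add: part_def)

text \<open>With \<open>state_card_N\<close> this makes the component regular of degree
  \<open>r (P x)\<close>.\<close>

lemma state_component:
  assumes "state P x" "y \<in> component (part P (P x)) x"
  shows "state P y \<and> P y = P x"
  using assms(2)
proof (induction rule: component_induct)
  case (step y z)
  then have "z \<in> N P (P y) y" by (auto simp: N_def part_def)
  then show ?case using step state_shift[of P y z] by (simp add: part_def)
qed (use assms in simp)

text \<open>Otherwise swapping two colours on one component of the part without \<^term>\<open>x\<close> makes two
neighbours of \<^term>\<open>x\<close> share a colour and frees one for \<^term>\<open>x\<close>.\<close>

lemma N_connected:
  assumes st: "state P x" and a: "a \<in> N P (P x) x" and b: "b \<in> N P (P x) x"
  shows "b \<in> component (part P (P x) - {x}) a"
proof (rule ccontr)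
  assume nb: "b \<notin> component (part P (P x) - {x}) a"
  let ?X = "part P (P x)" and ?n = "r (P x)"
  let ?C = "component (?X - {x}) a"
  have Px: "P x < s" using state_in[OF st] by auto
  obtain c where c: "proper_colouring (?X - {x}) E ?n c"
    using st Px by (auto simp: state_def valid_def colourable_def)
  have aX: "a \<in> ?X - {x}" and bX: "b \<in> ?X - {x}"
    using a b N_part edge_irrefl by (auto simp: N_def part_def dest: edge_in)
  have onto: "{..<?n} \<subseteq> d ` N P (P x) x" if d: "proper_colouring (?X - {x}) E ?n d" for d
  proof
    fix k assume "k \<in> {..<?n}"
    then show "k \<in> d ` N P (P x) x"
      using colour_missing[OF d, of k] valid_part_not_colourable[OF state_valid[OF st]]
      by (force simp: N_def part_def)
  qed
  define d where "d v = (if v \<in> ?C then (if c v = c a then c b else if c v = c b then c a else c v) else c v)" for v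
  have "proper_colouring (?X - {x}) E ?n d"
    unfolding proper_colouring_def
  proof (intro conjI ballI impI)
    fix v assume "v \<in> ?X - {x}"
    then show "d v < ?n" using c aX bX by (auto simp: d_def proper_colouring_def)
  next
    fix u v assume uv: "u \<in> ?X - {x}" "v \<in> ?X - {x}" "E u v"
    then have "c u \<noteq> c v" using c by (auto simp: proper_colouring_def)
    moreover have "u \<in> ?C \<longleftrightarrow> v \<in> ?C"
      using uv component_step edge_sym by blast
    ultimately show "d u \<noteq> d v" by (auto simp: d_def)
  qed
  then have "{..<?n} \<subseteq> d ` N P (P x) x" by (rule onto)
  moreover have "d a = d b" using nb by (auto simp: d_def)
  then have "d ` N P (P x) x = d ` (N P (P x) x - {a})"
  proof -
    have "b \<noteq> a" using nb by auto
    then show ?thesis using a b \<open>d a = d b\<close> by auto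
  qed
  then have "card (d ` N P (P x) x) \<le> card (N P (P x) x - {a})"
    by (metis card_image_le finite_Diff finite_N)
  then have "card (d ` N P (P x) x) < ?n"
    using card_Diff1_less[OF finite_N a] state_card_N[OF st] by simp
  ultimately show False
    using card_mono[of "d ` N P (P x) x" "{..<?n}"] finite_N by force
qed

text \<open>The component stays connected without its token: where a walk passes through
  \<open>x\<close>, \<open>N_connected\<close> supplies a detour.\<close>

lemma component_minus:
  assumes st: "state P x" and w: "w \<in> component (part P (P x)) x" "w \<noteq> x" and a: "a \<in> N P (P x) x"
  shows "w \<in> component (part P (P x) - {x}) a"
proof -
  have "w \<noteq> x \<longrightarrow> w \<in> component (part P (P x) - {x}) a"
    using w(1)
  proof (induction rule: component_induct)
    case (step y z)
    show ?case
    proof (cases "y = x")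
      case True
      then have "z \<in> N P (P x) x" using step by (auto simp: N_def part_def)
      then show ?thesis using N_connected[OF st a] by blast
    next
      case False
      then show ?thesis using step component_step[of y] by blast
    qed
  qed simp
  then show ?thesis using w by blast
qed

text \<open>The low vertices \<open>d\<close> and \<open>u\<close> exchange parts. Each neighbour of
  \<open>d\<close> in part \<open>P c\<close> then lies in the component of the token
  \<open>u\<close> but has lost \<open>d\<close>, so by regularity it is adjacent to
  \<open>u\<close>. For \<open>c\<close> this is the second claim; counting neighbours gives the
  first.\<close>

lemma twins_in_part:
  assumes c: "state P c" and r: "2 \<le> r (P c)" and d: "d \<in> N P (P c) c" "low d"
    and u: "low u" "P u \<noteq> P c" and sub: "N P (P c) c \<subseteq> nb u"
  shows "insert d (N P (P c) d) = insert c (N P (P c) c)" and "c \<in> nb u"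
proof -
  let ?i = "P c" and ?j = "P u"
  have Ecd: "E c d" and Pd: "P d = ?i" using d by (auto simp: N_def)
  have std: "state P d" using state_shift[OF c d(1)] .
  have Eud: "E u d" using sub d(1) by (auto simp: nb_def)
  have uV: "u \<in> V" using Eud edge_in by blast
  have j: "?j < s" using c uV by (auto simp: state_def valid_def)
  have i: "?i < s" using state_in(2)[OF c] .
  \<comment> \<open>Capacity at least 2 provides \<open>e\<close>, which will attach
    \<open>u\<close> to the rest of the component.\<close>
  have "card (N P ?i c - {d}) \<noteq> 0"
    using state_card_N[OF c] r d(1) finite_N by simp
  then obtain e where e: "e \<in> N P ?i c" "e \<noteq> d"
    by (metis Diff_iff card.empty equals0I insertI1)
  have Eue: "E u e" using sub e by (auto simp: nb_def)
  \<comment> \<open>The token moves with \<open>d\<close> to the part of \<open>u\<close>, passes to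
    \<open>u\<close>, and returns with \<open>u\<close>.\<close>
  let ?P1 = "P(d := ?j)"
  have ud: "u \<noteq> d" using u(2) Pd by auto
  have st1: "state ?P1 d" using state_move[OF std d(2) j] .
  have "u \<in> N ?P1 (?P1 d) d" using Eud edge_sym ud by (auto simp: N_def)
  then have st1u: "state ?P1 u" using state_shift[OF st1] by blast
  let ?P2 = "?P1(u := ?i)"
  have st2: "state ?P2 u" using state_move[OF st1u u(1) i] .
  have part2: "part P ?i - {d} \<subseteq> part ?P2 ?i" "u \<in> part ?P2 ?i" "e \<in> part ?P2 ?i"
    using uV e N_part[of P ?i c] by (auto simp: part_def)
  have ed: "e \<in> component (part P (P d)) d"
  proof -
    have "c \<in> component (part P ?i) d"
      using component_step[of d "part P ?i" d c] Ecd edge_sym edge_in Pd by (auto simp: part_def)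
    then show ?thesis
      using component_step[of c "part P ?i" d e] e N_part[of P ?i c] part_mem[OF c] Pd
      by (auto simp: N_def)
  qed
  have adj: "E u w" if w: "w \<in> N P ?i d" for w
  proof (rule ccontr)
    assume no: "\<not> E u w"
    have "e \<in> component (part P ?i - {d}) w"
      using component_minus[OF std ed e(2), of w] w Pd by simp
    then have "w \<in> component (part ?P2 ?i) e"
      using component_sym component_mono[OF part2(1)] by blast
    moreover have "e \<in> component (part ?P2 ?i) u"
      using component_step[of u _ u e] part2 Eue by auto
    ultimately have "w \<in> component (part ?P2 (?P2 u)) u"
      using component_trans by simp
    then have "state ?P2 w" "?P2 w = ?i"
      using state_component[OF st2] by auto
    then have c2: "card (N ?P2 ?i w) = r ?i"
      using state_card_N[of ?P2 w] by simp
    have "state P w" "P w = ?i"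
      using state_shift[OF std] w Pd by (auto simp: N_def)
    then have c1: "card (N P ?i w) = r ?i"
      using state_card_N[of P w] by simp
    have dw: "d \<in> N P ?i w" using w edge_sym Pd by (auto simp: N_def)
    have "N ?P2 ?i w \<subseteq> N P ?i w - {d}"
      using no edge_sym u(2) ud by (auto simp: N_def split: if_splits)
    then have "card (N ?P2 ?i w) \<le> card (N P ?i w - {d})"
      by (intro card_mono) (auto simp: finite_N)
    also have "\<dots> < card (N P ?i w)"
      using card_Diff1_less[OF finite_N dw] .
    finally show False using c1 c2 by simp
  qed
  have eq1: "N ?P2 ?i u = N P ?i u - {d}"
    using u(2) ud edge_irrefl by (auto simp: N_def split: if_splits)
  have "N P ?i d \<subseteq> N ?P2 ?i u"
    using adj edge_irrefl by (auto simp: N_def eq1)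
  moreover have "card (N P ?i d) = card (N ?P2 ?i u)"
    using state_card_N[OF std] state_card_N[OF st2] Pd by simp
  ultimately have eq2: "N P ?i d = N P ?i u - {d}"
    using card_subset_eq[OF finite_N] eq1 by metis
  have cd: "c \<in> N P ?i d" using Ecd edge_sym by (auto simp: N_def)
  then show "c \<in> nb u" using adj by (auto simp: nb_def)
  have "N P ?i c - {d} \<subseteq> N P ?i d"
    unfolding eq2 using sub by (auto simp: N_def nb_def)
  then have "insert c (N P ?i c - {d}) \<subseteq> N P ?i d" using cd by blast
  moreover have "card (insert c (N P ?i c - {d})) = card (N P ?i d)"
  proof -
    have "c \<notin> N P ?i c - {d}" using edge_irrefl by (auto simp: N_def)
    then have "card (insert c (N P ?i c - {d})) = card (N P ?i c)"
      using card_Suc_Diff1[OF finite_N d(1)] by (simp add: finite_N)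
    then show ?thesis
      using state_card_N[OF std] state_card_N[OF c] Pd by simp
  qed
  ultimately have "insert c (N P ?i c - {d}) = N P ?i d"
    using card_subset_eq[OF finite_N] by blast
  then show "insert d (N P ?i d) = insert c (N P ?i c)"
    using d(1) by blast
qed

text \<open>With \<open>u\<close> in part \<open>l\<close>, regularity gives \<open>w\<close>
  exactly \<open>r l\<close> neighbours there; it had fewer before, so it gained
  \<open>u\<close>.\<close>

lemma enter_adjacent:
  assumes "state P u" "low u" "l < s"
    and w: "w \<in> component (part (P(u := l)) l) u" "card (N P l w) < r l"
  shows "E u w"
proof (rule ccontr)
  assume no: "\<not> E u w"
  let ?P = "P(u := l)"
  have st: "state ?P u" using state_move assms by blast
  then have "state ?P w" "?P w = l"
    using state_component[OF st, of w] w by auto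
  then have "card (N ?P l w) = r l" using state_card_N[of ?P w] by simp
  moreover have "N ?P l w \<subseteq> N P l w"
    using no edge_sym by (auto simp: N_def split: if_splits)
  then have "card (N ?P l w) \<le> card (N P l w)"
    by (rule card_mono[OF finite_N])
  ultimately show False using w(2) by simp
qed

text \<open>Otherwise low and high vertices form a bipartition of the component, as high vertices
  are independent; two colours then suffice for it, and the part fits its capacity.\<close>

lemma ex_adjacent_low:
  assumes st: "state P x" and r: "2 \<le> r (P x)"
  obtains c d where "c \<in> component (part P (P x)) x" "state P c" "P c = P x"
    "low c" "low d" "d \<in> N P (P x) c"
proof (rule ccontr)
  assume no: "\<not> thesis"
  note goal = that
  let ?X = "part P (P x)"
  let ?Q = "component ?X x"
  have no': "\<not> (low c \<and> low d)" if "c \<in> ?Q" "d \<in> ?X" "E c d" for c d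
    using that(1) no goal[of c d] state_component[OF st that(1)] that(2,3)
    by (auto simp: N_def part_def)
  have QX: "?Q \<subseteq> ?X" using component_subset[OF part_mem[OF st]] .
  obtain f where f: "proper_colouring (?X - {x}) E (r (P x)) f"
    using st state_in(2)[OF st] by (auto simp: state_def valid_def colourable_def)
  define g where "g v = (if v \<in> ?Q then if low v then 0 else 1 else f v)" for v
  have "proper_colouring ?X E (r (P x)) g"
    unfolding proper_colouring_def
  proof (intro conjI ballI impI)
    fix v assume v: "v \<in> ?X"
    have "v \<noteq> x" if "v \<notin> ?Q" using that by auto
    then show "g v < r (P x)" using v r f by (auto simp: g_def proper_colouring_def)
  next
    fix u v assume uv: "u \<in> ?X" "v \<in> ?X" "E u v"
    have Q: "u \<in> ?Q \<longleftrightarrow> v \<in> ?Q" using component_step edge_sym uv by blast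
    show "g u \<noteq> g v"
    proof (cases "u \<in> ?Q")
      case True
      have "low u \<noteq> low v"
        using no'[OF True uv(2,3)] high_indep[OF uv(3)] by (auto simp: low_def)
      then show ?thesis using True Q by (auto simp: g_def)
    next
      case False
      then have "u \<noteq> x" "v \<noteq> x" using Q by auto
      then show ?thesis using False Q f uv by (auto simp: g_def proper_colouring_def)
    qed
  qed
  then show False
    using valid_part_not_colourable[OF state_valid[OF st]] by (auto simp: colourable_def)
qed

text \<open>By \<open>twins_in_part\<close> each low vertex of \<open>K\<close> has closed
  neighbourhood \<open>K\<close> in the part, so non-adjacent vertices of \<open>K\<close> are high,
  and \<open>colourable_merge\<close> would colour the part. A clique on \<open>r (P c) + 1\<close>
  vertices uses up the degrees of its members, so no edge of the component leaves it.\<close>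

lemma clique_component:
  assumes c: "state P c" "low c" and r: "2 \<le> r (P c)" and d: "d \<in> N P (P c) c" "low d"
    and u: "low u" "P u \<noteq> P c" and sub: "N P (P c) c \<subseteq> nb u"
  shows "x \<in> insert c (N P (P c) c) \<Longrightarrow> y \<in> insert c (N P (P c) c) \<Longrightarrow> x \<noteq> y \<Longrightarrow> E x y"
    and "component (part P (P c)) c \<subseteq> insert c (N P (P c) c)"
proof -
  let ?i = "P c"
  define K where "K = insert c (N P ?i c)"
  define Hs where "Hs = {w \<in> K. \<not> low w}"
  have K_state: "state P w" "P w = ?i" "w \<in> part P ?i" if "w \<in> K" for w
    using that c state_shift[OF c(1)] state_in(1)[OF c(1)] edge_in by (auto simp: K_def N_def part_def)
  have twin: "insert w (N P ?i w) = K" if "w \<in> K" "low w" for w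
    using that twins_in_part(1)[OF c(1) r _ _ u sub] by (auto simp: K_def)
  have cN: "c \<notin> N P ?i c" using edge_irrefl by (auto simp: N_def)
  have cardK: "card K = r ?i + 1"
    using cN finite_N state_card_N[OF c(1)] by (simp add: K_def)
  have finK: "finite K" by (simp add: K_def finite_N)
  have finH: "finite Hs" using finK by (simp add: Hs_def)
  have HK: "Hs \<subseteq> K" by (auto simp: Hs_def)
  have cardKH: "card (K - Hs) = r ?i + 1 - card Hs"
    using card_Diff_subset[OF finH HK] cardK by simp
  have "{c, d} \<subseteq> K - Hs" using c d by (auto simp: K_def Hs_def)
  then have "card {c, d} \<le> card (K - Hs)" using finK by (intro card_mono) auto
  moreover have "c \<noteq> d" using cN d by auto
  ultimately have h: "card Hs + 1 \<le> r ?i" using cardKH by simp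
  have clique: "E x y" if xy: "x \<in> K" "y \<in> K" "x \<noteq> y" for x y
  proof (rule ccontr)
    assume no: "\<not> E x y"
    have "\<not> low x" using twin[of x] xy no by (auto simp: N_def)
    moreover have "\<not> low y" using twin[of y] xy no edge_sym by (auto simp: N_def)
    ultimately have "{x, y} \<subseteq> Hs" using xy by (auto simp: Hs_def)
    then have "card {x, y} \<le> card Hs" using finH by (intro card_mono)
    then have h2: "2 \<le> card Hs" using xy by simp
    have "colourable E (part P ?i) (r ?i)"
    \<comment> \<open>Of its \<open>r ?i\<close> neighbours in the part, a vertex of
      \<open>Hs\<close> has \<open>r ?i + 1 - card Hs\<close> in \<open>K - Hs\<close>, which leaves
      \<open>m\<close>.\<close>
    proof (rule colourable_merge[where K = K and Hs = Hs and m = "card Hs - 1"])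
      show "finite (part P ?i)" using finite_V by (simp add: part_def)
      show "K \<subseteq> part P ?i" using K_state by blast
      show "\<not> E v w" if "v \<in> Hs" "w \<in> Hs" for v w
        using high_indep[of v w] that by (auto simp: Hs_def low_def)
      show "v \<in> K" if "w \<in> K - Hs" "v \<in> part P ?i" "E w v" for w v
      proof -
        have "v \<in> N P ?i w" using that by (auto simp: N_def part_def)
        then show ?thesis using twin[of w] that by (auto simp: Hs_def)
      qed
      show "card {v. E w v \<and> v \<in> part P ?i - K} \<le> card Hs - 1" if w: "w \<in> Hs" for w
      proof -
        have sub: "K - Hs \<subseteq> N P ?i w"
        proof
          fix z assume z: "z \<in> K - Hs"
          then have "w \<in> N P ?i z" using twin[of z] w by (auto simp: Hs_def)
          then show "z \<in> N P ?i w" using edge_sym K_state(2)[of z] z by (auto simp: N_def)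
        qed
        have "{v. E w v \<and> v \<in> part P ?i - K} \<subseteq> N P ?i w - (K - Hs)"
          by (auto simp: N_def part_def)
        then have "card {v. E w v \<and> v \<in> part P ?i - K} \<le> card (N P ?i w - (K - Hs))"
          by (intro card_mono) (auto simp: finite_N)
        also have "\<dots> = card (N P ?i w) - card (K - Hs)"
          using card_Diff_subset[OF finite_subset[OF sub finite_N] sub] .
        also have "card (N P ?i w) = r ?i"
          using state_card_N[of P w] K_state[of w] w by (auto simp: Hs_def)
        finally show ?thesis using cardKH h by linarith
      qed
      \<comment> \<open>The inequality becomes \<open>3 + a + q < (2 + a) * (2 + q)\<close>.\<close>
      obtain q where q: "r ?i = card Hs + 1 + q" using h le_Suc_ex by blast
      obtain a where a: "card Hs = 2 + a" using h2 le_Suc_ex by blast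
      show "r ?i < card Hs * (r ?i - (card Hs - 1))"
        unfolding q a by simp
      have "colourable E (part P ?i - {c}) (r ?i)"
        using c(1) state_in(2)[OF c(1)] by (simp add: state_def valid_def)
      then show "colourable E (part P ?i - K) (r ?i)"
        by (rule colourable_mono) (auto simp: K_def)
    qed (use cardK HK in auto)
    then show False using valid_part_not_colourable[OF state_valid[OF c(1)]] by blast
  qed
  then show "x \<in> insert c (N P ?i c) \<Longrightarrow> y \<in> insert c (N P ?i c) \<Longrightarrow> x \<noteq> y \<Longrightarrow> E x y"
    by (simp add: K_def)
  have "y \<in> K" if "y \<in> component (part P ?i) c" for y
    using that
  proof (induction rule: component_induct)
    case (step y z)
    have "K - {y} \<subseteq> N P ?i y"
      using clique[of y] step K_state by (auto simp: N_def)
    moreover have "card (K - {y}) = card (N P ?i y)"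
      using step cardK state_card_N[of P y] K_state[of y] by simp
    ultimately have "K - {y} = N P ?i y" using card_subset_eq[OF finite_N] by blast
    moreover have "z \<in> N P ?i y" using step by (auto simp: N_def part_def)
    ultimately show ?case by blast
  qed (simp add: K_def)
  then show "component (part P ?i) c \<subseteq> insert c (N P ?i c)" by (auto simp: K_def)
qed

section \<open>Frozen components and the return of the token\<close>

text \<open>A union of components of the parts in \<^term>\<open>I\<close> that no low vertex outside
\<^term>\<open>W \<union> Y\<close> can enter: a low vertex entering a component is adjacent to all its vertices
of deficient degree.\<close>

definition frozen :: "('a \<Rightarrow> nat) \<Rightarrow> nat set \<Rightarrow> 'a set \<Rightarrow> 'a set \<Rightarrow> bool" where
  "frozen P I W Y \<longleftrightarrow> (\<forall>w\<in>W. w \<in> V \<and> P w \<in> I)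
    \<and> (\<forall>w\<in>W. \<forall>v\<in>V. E w v \<and> P v = P w \<longrightarrow> v \<in> W)
    \<and> (\<forall>w\<in>W. \<forall>u. u \<notin> W \<and> u \<notin> Y \<and> low u \<and> P u \<in> I \<and> P u \<noteq> P w \<longrightarrow>
        (\<exists>e \<in> component (part P (P w)) w. card (N P (P w) e) < r (P w) \<and> \<not> E u e))"

lemma frozenD:
  assumes "frozen P I W Y"
  shows "w \<in> W \<Longrightarrow> w \<in> V" "w \<in> W \<Longrightarrow> P w \<in> I"
    "w \<in> W \<Longrightarrow> v \<in> V \<Longrightarrow> E w v \<Longrightarrow> P v = P w \<Longrightarrow> v \<in> W"
    "w \<in> W \<Longrightarrow> u \<notin> W \<Longrightarrow> u \<notin> Y \<Longrightarrow> low u \<Longrightarrow> P u \<in> I \<Longrightarrow> P u \<noteq> P w \<Longrightarrow>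
      \<exists>e \<in> component (part P (P w)) w. card (N P (P w) e) < r (P w) \<and> \<not> E u e"
  using assms unfolding frozen_def by blast+

text \<open>\<open>W\<close> is closed under adjacency inside parts, so the component stays
  connected when vertices outside \<open>W\<close> move.\<close>

lemma frozen_component:
  assumes "frozen P I W Y" "w \<in> W" "e \<in> component (part P (P w)) w"
  shows "e \<in> component (part P (P w) \<inter> W) w"
proof -
  have "e \<in> component (part P (P w) \<inter> W) w \<and> e \<in> W"
    using assms(3)
  proof (induction rule: component_induct)
    case (step y z)
    have z: "z \<in> W"
      using frozenD(3)[OF assms(1), of y z] step by (auto simp: part_def)
    then show ?case
      using step component_step[of y "part P (P w) \<inter> W" w z] by blast
  qed (simp add: assms(2))
  then show ?thesis by blast
qed

text \<open>No vertex of \<open>W\<close> is adjacent to \<open>c\<close>, so \<open>W\<close> stays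
  frozen. The rest of the component of \<open>c\<close> joins it: the neighbours of \<open>c\<close>
  there become deficient, and by \<open>esc\<close> each low vertex of part \<open>b\<close> outside
  \<open>W\<close> misses one of them.\<close>

lemma frozen_move:
  assumes st: "state P c" and low: "low c" and b: "b < s" "b \<noteq> P c" and I: "I = {P c, b}"
    and cW: "c \<notin> W" and fr: "frozen P I W (component (part P (P c)) c - {c})"
    and esc: "\<And>u. low u \<Longrightarrow> P u = b \<Longrightarrow> u \<notin> W \<Longrightarrow> \<not> N P (P c) c \<subseteq> nb u"
  shows "frozen (P(c := b)) I (W \<union> (component (part P (P c)) c - {c})) {c}"
    and "\<And>z. E c z \<Longrightarrow> P z = P c \<Longrightarrow> z \<in> component (part P (P c)) c - {c}"
proof -
  let ?a = "P c"
  let ?P = "P(c := b)"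
  define Q where "Q = component (part P ?a) c - {c}"
  have Qa: "P w = ?a" "w \<in> V" "state P w" if "w \<in> Q" for w
    using state_component[OF st, of w] that state_in(1)[of P w] by (auto simp: Q_def)
  have Q_nb: "z \<in> Q" if "E c z" "P z = ?a" for z
    using component_step[of c "part P ?a" c z] that part_mem[OF st] edge_in edge_irrefl
    by (auto simp: Q_def part_def)
  then show "\<And>z. E c z \<Longrightarrow> P z = P c \<Longrightarrow> z \<in> component (part P (P c)) c - {c}"
    by (simp add: Q_def)
  \<comment> \<open>Such a \<open>w\<close> would lie in part \<open>b\<close>. On entering,
    \<open>c\<close> would have to be adjacent to all deficient vertices of the component of
    \<open>w\<close>, but it misses one.\<close>
  have no_edge: "\<not> E w c" if w: "w \<in> W" for w
  proof
    assume Ewc: "E w c"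
    have wa: "P w \<noteq> ?a"
      using frozenD(3)[OF fr w _ Ewc] cW state_in(1)[OF st] by auto
    then have wb: "P w = b" using frozenD(2)[OF fr w] I by auto
    obtain e where e: "e \<in> component (part P b) w" "card (N P b e) < r b" "\<not> E c e"
      using frozenD(4)[OF fr w cW _ low] wa wb I by auto
    have "part P b \<subseteq> part ?P b" by (auto simp: part_def)
    then have "e \<in> component (part ?P b) w" using component_mono e(1) by blast
    moreover have "w \<in> component (part ?P b) c"
      using component_step[of c "part ?P b" c w] Ewc edge_sym edge_in wb by (auto simp: part_def)
    ultimately have "e \<in> component (part ?P b) c" using component_trans by blast
    then show False using enter_adjacent[OF st low b(1)] e by blast
  qed
  have "frozen ?P I (W \<union> Q) {c}"
    unfolding frozen_def
  proof (intro conjI ballI allI impI; (elim conjE)?)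
    fix w assume "w \<in> W \<union> Q"
    then show "w \<in> V" using Qa frozenD(1)[OF fr] by blast
  next
    fix w assume "w \<in> W \<union> Q"
    then show "?P w \<in> I" using Qa frozenD(2)[OF fr] I by auto
  next
    fix w v assume w: "w \<in> W \<union> Q" and v: "v \<in> V" "E w v" "?P v = ?P w"
    have wc: "w \<noteq> c" using w cW by (auto simp: Q_def)
    show "v \<in> W \<union> Q"
    proof (cases "v = c")
      case True
      then have "w \<in> W" using v(3) w wc Qa(1) b(2) by auto
      then show ?thesis using no_edge v True by blast
    next
      case False
      then have Pv: "P v = P w" using v wc by simp
      show ?thesis
      proof (cases "w \<in> W")
        case True
        then show ?thesis using frozenD(3)[OF fr True v(1,2) Pv] by blast
      next
        case False
        then have "w \<in> Q" using w by blast
        then have "v \<in> component (part P ?a) c"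
          using component_step[of w "part P ?a" c v] Qa[of w] v Pv by (auto simp: Q_def part_def)
        then show ?thesis using \<open>v \<noteq> c\<close> by (simp add: Q_def)
      qed
    qed
  next
    fix w u assume w: "w \<in> W \<union> Q"
      and u: "u \<notin> W \<union> Q" "u \<notin> {c}" "low u" "?P u \<in> I" "?P u \<noteq> ?P w"
    have wc: "w \<noteq> c" using w cW by (auto simp: Q_def)
    have Pu: "P u \<in> I" "P u \<noteq> P w" using u wc by auto
    show "\<exists>e\<in>component (part ?P (?P w)) w. card (N ?P (?P w) e) < r (?P w) \<and> \<not> E u e"
    proof (cases "w \<in> W")
      case True
      obtain e where e: "e \<in> component (part P (P w)) w" "card (N P (P w) e) < r (P w)" "\<not> E u e"
        using frozenD(4)[OF fr True _ _ u(3) Pu] u(1) by (auto simp: Q_def)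
      have "e \<in> component (part P (P w) \<inter> W) w"
        using frozen_component[OF fr True e(1)] .
      moreover have "part P (P w) \<inter> W \<subseteq> part ?P (P w)"
        using cW by (auto simp: part_def)
      ultimately have 1: "e \<in> component (part ?P (P w)) w"
        using component_mono by blast
      have "part P (P w) \<inter> W \<subseteq> W" by blast
      moreover have "w \<in> part P (P w) \<inter> W"
        using True frozenD(1)[OF fr] by (auto simp: part_def)
      ultimately have "e \<in> W"
        using component_subset \<open>e \<in> component (part P (P w) \<inter> W) w\<close> by blast
      then have "N ?P (P w) e \<subseteq> N P (P w) e"
        using no_edge by (auto simp: N_def split: if_splits)
      then have "card (N ?P (P w) e) < r (P w)"
        using card_mono[OF finite_N] e(2) le_less_trans by blast
      then show ?thesis using 1 e(3) wc by auto
    next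
      case False
      then have wQ: "w \<in> Q" using w by blast
      then have Pw: "P w = ?a" using Qa by blast
      then have "P u = b" using Pu I by auto
      then obtain e where e: "e \<in> N P ?a c" "\<not> E u e"
        using esc[of u] u by (auto simp: nb_def)
      have "w \<in> component (part P ?a - {c}) e"
        using component_minus[OF st _ _ e(1)] wQ by (auto simp: Q_def)
      moreover have "part ?P ?a = part P ?a - {c}" using b(2) by (auto simp: part_def)
      ultimately have "e \<in> component (part ?P ?a) w" using component_sym by simp
      moreover have "card (N ?P ?a e) < r ?a"
      proof -
        have "c \<in> N P ?a e" using e(1) edge_sym by (auto simp: N_def)
        moreover have "N ?P ?a e = N P ?a e - {c}" using b(2) by (auto simp: N_def)
        moreover have "card (N P ?a e) = r ?a"
          using state_card_N[OF state_shift[OF st e(1)]] e(1) by (simp add: N_def)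
        ultimately show ?thesis using card_Diff1_less[OF finite_N] by metis
      qed
      ultimately show ?thesis using e(2) Pw wc by auto
    qed
  qed
  then show "frozen ?P I (W \<union> (component (part P ?a) c - {c})) {c}"
    by (simp add: Q_def)
qed

text \<open>The token \<^term>\<open>y\<close> has just left the part \<^term>\<open>b\<close>, so its neighbours there are frozen. It
can always hand over to a vertex \<^term>\<open>c\<close> of its component so that the rest of the component
can be frozen too; as \<^term>\<open>V\<close> is finite, this cannot go on.\<close>

lemma no_ping_pong:
  assumes "state P y" "low y" "a = P y" "b < s" "b \<noteq> a" "y \<notin> W"
    and "frozen P {a, b} W {y}"
    and "\<And>z. E y z \<Longrightarrow> P z = b \<Longrightarrow> z \<in> W"
  shows False
  using assms
proof (induction "card (V - W)" arbitrary: P y W a b rule: less_induct)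
  case less
  note st = less.prems(1) and low = less.prems(2) and a = less.prems(3) and b = less.prems(4,5)
    and yW = less.prems(6) and fr = less.prems(7) and yfact = less.prems(8)
  let ?Q = "component (part P a) y"
  have as: "a < s" using state_in(2)[OF st] a by simp
  have ra: "1 \<le> r a" using r_0 r_pos[of a] as by (cases "a = 0") auto
  have "\<exists>c. c \<in> ?Q \<and> c \<noteq> y \<and> low c \<and> (\<forall>u. low u \<and> P u = b \<and> u \<notin> W \<longrightarrow> \<not> N P a c \<subseteq> nb u)"
  proof (cases "\<exists>c\<in>N P a y. low c")
    \<comment> \<open>A low neighbour \<open>c\<close> works: \<open>y\<close> lies in
      \<open>N P a c\<close>, and no vertex of part \<open>b\<close> outside \<open>W\<close> is
      adjacent to \<open>y\<close>.\<close>
    case True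
    then obtain c where c: "c \<in> N P a y" "low c" by blast
    have "c \<in> ?Q"
      using component_step[of y "part P a" y c] c part_mem[OF st] a N_part[of P a y]
      by (auto simp: N_def)
    moreover have "c \<noteq> y" using c edge_irrefl by (auto simp: N_def)
    moreover have "y \<in> N P a c" using c a edge_sym by (auto simp: N_def)
    ultimately show ?thesis
      using c yfact edge_sym by (intro exI[of _ c]) (auto simp: nb_def)
  next
    \<comment> \<open>All neighbours of \<open>y\<close> in its part are high. If a low
      \<open>u\<close> in part \<open>b\<close> saw all of \<open>N P a c\<close>, then
      \<open>clique_component\<close> would make \<open>y\<close> adjacent to the low vertex
      \<open>c\<close>.\<close>
    case False
    have "N P a y \<noteq> {}" using state_card_N[OF st] ra a by auto
    then obtain h where "\<not> low h" using False by blast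
    then have "2 \<le> r 0" using high_r_0[of h] by (simp add: low_def)
    then have r2: "2 \<le> r a" using r_pos[of a] as by (cases "a = 0") auto
    obtain c d where cd: "c \<in> ?Q" "state P c" "P c = a" "low c" "low d" "d \<in> N P a c"
      using ex_adjacent_low[OF st] r2 a by metis
    have cy: "c \<noteq> y" using cd False by blast
    have "\<not> N P a c \<subseteq> nb u" if u: "low u" "P u = b" for u
    proof
      assume sub: "N P a c \<subseteq> nb u"
      have "y \<in> component (part P a) c"
        using component_sym[OF cd(1)] .
      then have "y \<in> insert c (N P a c)"
        using clique_component(2)[OF cd(2,4) _ _ cd(5) u(1)] cd r2 sub u b by auto
      then have "c \<in> N P a y" using cy cd(3) edge_sym by (auto simp: N_def)
      then show False using False cd by blast
    qed
    then show ?thesis using cd cy by blast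
  qed
  then obtain c where c: "c \<in> ?Q" "c \<noteq> y" "low c"
    and esc: "\<And>u. low u \<Longrightarrow> P u = b \<Longrightarrow> u \<notin> W \<Longrightarrow> \<not> N P a c \<subseteq> nb u" by blast
  have stc: "state P c" and Pc: "P c = a"
    using state_component[OF st, of c] c(1) a by simp_all
  have Qc: "component (part P a) c = ?Q"
    using component_trans[OF c(1)] component_trans[OF component_sym[OF c(1)]] by blast
  have disj: "w \<notin> W" if "w \<in> ?Q" for w
    using that
  proof (induction rule: component_induct)
    case (step w z)
    then show ?case using frozenD(3)[OF fr, of z w] edge_sym by (auto simp: part_def)
  qed (rule yW)
  let ?W = "W \<union> (?Q - {c})"
  \<comment> \<open>The exempt vertex \<open>y\<close> differs from \<open>c\<close>, so it is among
    the vertices about to be frozen.\<close>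
  have frc: "frozen P {a, b} W (component (part P (P c)) c - {c})"
    using fr c(2) unfolding frozen_def Pc Qc by (blast intro: component_refl)
  note new = frozen_move[OF stc c(3) b(1) _ _ disj[OF c(1)] frc, unfolded Pc Qc]
  have frW: "frozen (P(c := b)) {b, a} ?W {c}"
    using new(1) esc b by (simp add: insert_commute)
  have "card (V - ?W) < card (V - W)"
  proof (rule psubset_card_mono)
    have "y \<in> ?W" using c(2) by simp
    then show "V - ?W \<subset> V - W" using yW state_in(1)[OF st] by blast
  qed (simp add: finite_V)
  moreover have "z \<in> ?W" if "E c z" "(P(c := b)) z = a" for z
    using new(2)[of z] that esc b by (auto split: if_splits)
  \<comment> \<open>The parts swap roles: the token \<open>c\<close> is now in part \<open>b\<close>
    and has just left part \<open>a\<close>.\<close>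
  ultimately show ?case
    using less.hyps[of ?W "P(c := b)" c b a] state_move[OF stc c(3) b(1)] c(3) as b(2)
      frW disj[OF c(1)] by auto
qed

text \<open>Otherwise \<open>frozen_move\<close> applies with an empty frozen set, and moving
  \<open>c\<close> into part \<open>b\<close> yields the situation excluded by
  \<open>no_ping_pong\<close>.\<close>

lemma ex_return:
  assumes st: "state P c" and low: "low c" and b: "b < s" "b \<noteq> P c"
  shows "\<exists>u. low u \<and> P u = b \<and> N P (P c) c \<subseteq> nb u"
proof (rule ccontr)
  assume no: "\<not> ?thesis"
  have "frozen P {P c, b} {} Y" for Y by (simp add: frozen_def)
  note new = frozen_move[OF st low b refl _ this]
  show False
  proof (rule no_ping_pong[of "P(c := b)" c b "P c"])
    show "frozen (P(c := b)) {b, P c} (component (part P (P c)) c - {c}) {c}"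
      using new(1) no by (auto simp: insert_commute)
    show "z \<in> component (part P (P c)) c - {c}" if "E c z" "(P(c := b)) z = P c" for z
      using new(2)[of z] no that b by (auto split: if_splits)
  qed (use state_move[OF st low b(1)] low b state_in(2)[OF st] in auto)
qed

section \<open>Twins and the clique\<close>

lemma ex_other_part: "\<exists>j<s. j \<noteq> i" for i
  using two_parts by (intro exI[of _ "if i = 0 then 1 else 0"]) auto

text \<open>Inside the part this is \<open>twins_in_part\<close>. In another part \<open>j\<close>,
  some \<open>u\<close> from \<open>ex_return\<close> is adjacent to both. If \<open>w\<close>
  enters, its neighbours there are linked to \<open>u\<close> without \<open>w\<close>, so they also
  lie in the component of \<open>c\<close> when \<open>c\<close> enters instead. Each of them needs
  \<open>w\<close> to reach degree \<open>r j\<close>, so \<open>enter_adjacent\<close> makes it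
  adjacent to \<open>c\<close>.\<close>

lemma low_twins:
  assumes c: "state P c" "low c" and r: "2 \<le> r (P c)" and w: "w \<in> N P (P c) c" "low w"
  shows "insert w (nb w) = insert c (nb c)"
proof -
  let ?i = "P c"
  have Pw: "P w = ?i" and Ecw: "E c w" using w by (auto simp: N_def)
  have stw: "state P w" using state_shift[OF c(1) w(1)] .
  have wc: "w \<noteq> c" using Ecw edge_irrefl by auto
  have other: "N P j w = N P j c" if j: "j < s" "j \<noteq> ?i" for j
  proof -
    obtain u where u: "low u" "P u = j" "N P ?i c \<subseteq> nb u"
      using ex_return[OF c j] by blast
    have Ewu: "E w u" using u w edge_sym by (auto simp: nb_def)
    have uj: "P u \<noteq> ?i" using u(2) j(2) by simp
    have Ecu: "E c u"
      using twins_in_part(2)[OF c(1) r w u(1) uj u(3)] edge_sym by (auto simp: nb_def)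
    let ?Pw = "P(w := j)" and ?Pc = "P(c := j)"
    have st: "state ?Pw w" using state_move[OF stw w(2) j(1)] .
    have "N P j w \<subseteq> N P j c"
    proof
      fix e assume e: "e \<in> N P j w"
      have eN: "e \<in> N ?Pw (?Pw w) w" and uN: "u \<in> N ?Pw (?Pw w) w"
        using e Ewu u(2) N_upd[of P w j j] by (auto simp: N_def)
      have "e \<in> component (part ?Pw j - {w}) u"
        using N_connected[OF st uN eN] by simp
      moreover have "part ?Pw j - {w} \<subseteq> part ?Pc j" by (auto simp: part_def)
      ultimately have "e \<in> component (part ?Pc j) u" using component_mono by blast
      moreover have "u \<in> component (part ?Pc j) c"
        using component_step[of c "part ?Pc j" c u] Ecu u(2) edge_in by (auto simp: part_def)
      ultimately have ec: "e \<in> component (part ?Pc j) c" using component_trans by blast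
      have "state ?Pw e" "?Pw e = j" using state_shift[OF st eN] eN by (auto simp: N_def)
      then have "card (N ?Pw j e) = r j" using state_card_N[of ?Pw e] by simp
      moreover have "N P j e = N ?Pw j e - {w}" using Pw j(2) by (auto simp: N_def)
      moreover have "w \<in> N ?Pw j e" using e edge_sym by (auto simp: N_def)
      ultimately have "card (N P j e) < r j" using card_Diff1_less[OF finite_N] by metis
      then have "E c e" using enter_adjacent[OF c j(1) ec] by blast
      then show "e \<in> N P j c" using e by (auto simp: N_def)
    qed
    moreover have "card (N P j w) = card (N P j c)"
      using low_card_N[OF stw w(2) j(1)] low_card_N[OF c j(1)] by simp
    ultimately show ?thesis using card_subset_eq[OF finite_N] by blast
  qed
  obtain j where j: "j < s" "j \<noteq> ?i"
    using ex_other_part by blast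
  obtain u where u: "low u" "P u = j" "N P ?i c \<subseteq> nb u"
    using ex_return[OF c j] by blast
  have same: "insert w (N P ?i w) = insert c (N P ?i c)"
    using twins_in_part(1)[OF c(1) r w u(1) _ u(3)] u(2) j by simp
  have "v \<in> insert w (nb w) \<longleftrightarrow> v \<in> insert c (nb c)" for v
  proof (cases "v \<in> V \<and> P v \<noteq> ?i")
    case True
    then have "N P (P v) w = N P (P v) c"
      using other state_valid[OF c(1)] by (simp add: valid_def)
    moreover have "v \<noteq> w" "v \<noteq> c" using True Pw by auto
    ultimately show ?thesis by (auto simp: N_def nb_def)
  next
    case False
    then have "v \<in> V \<Longrightarrow> P v = ?i" by blast
    then have "v \<in> insert x (nb x) \<longleftrightarrow> v \<in> insert x (N P ?i x)" for x
      using edge_in by (auto simp: N_def nb_def)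
    then show ?thesis using same by blast
  qed
  then show ?thesis by blast
qed

text \<open>\<open>X\<close> collects the vertices of \<open>K\<close> whose closed neighbourhood is
  not \<open>K\<close>. Each part holds at most one of them. Two or more would all be high, and
  \<open>colourable_merge\<close> would give a \<open>t\<close>-colouring; with at most one,
  \<open>K\<close> is a clique.\<close>

lemma ex_clique:
  assumes few: "\<And>v. \<not> low v \<Longrightarrow> 5 * (s - 1) \<le> t"
  shows "\<exists>K \<subseteq> V. card K = t + 1 \<and> (\<forall>x\<in>K. \<forall>y\<in>K. x \<noteq> y \<longrightarrow> E x y)"
proof -
  have "\<exists>P x. state P x \<and> 2 \<le> r (P x)"
  proof -
    obtain P x where st: "state P x" using ex_state by blast
    show ?thesis
    proof (cases "2 \<le> r (P x)")
      \<comment> \<open>Only part \<open>0\<close> can have capacity 1, and then no vertex is high,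
        so the token may move to part \<open>1\<close>.\<close>
      case False
      then have "P x = 0" using r_pos[of "P x"] state_in(2)[OF st] by auto
      then have "low x" using high_r_0[of x] False by (fastforce simp: low_def)
      then have "state (P(x := 1)) x" using state_move[OF st] two_parts by simp
      moreover have "2 \<le> r 1" using r_pos two_parts by simp
      ultimately show ?thesis by (metis fun_upd_same)
    qed (use st in blast)
  qed
  then obtain P x0 where "state P x0" "2 \<le> r (P x0)" by blast
  then obtain c d where c: "state P c" "low c" and r: "2 \<le> r (P c)"
    and d: "d \<in> N P (P c) c" "low d"
    using ex_adjacent_low by metis
  let ?i = "P c"
  define K where "K = insert c (nb c)"
  define X where "X = {w \<in> K. insert w (nb w) \<noteq> K}"
  have si: "?i < s" and cV: "c \<in> V" using state_in[OF c(1)] by auto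
  have Ps: "P v < s" if "v \<in> V" for v
    using that state_valid[OF c(1)] by (simp add: valid_def)
  have KV: "K \<subseteq> V" using cV nb_subset by (auto simp: K_def)
  have finK: "finite K" by (simp add: K_def finite_nb)
  have "card (nb c) = t"
    using sum_card_N[of P c] Ps low_card_N[OF c] sum_r by simp
  moreover have "c \<notin> nb c" using edge_irrefl by (simp add: nb_def)
  ultimately have cardK: "card K = t + 1" by (simp add: K_def finite_nb)
  have XK: "X \<subseteq> K" by (auto simp: X_def)
  have finX: "finite X" using XK finK finite_subset by blast
  \<comment> \<open>Moving \<open>c\<close> to part \<open>j\<close> makes the results about the
    part of the token available for every part.\<close>
  have moved: "state (P(c := j)) c" "N (P(c := j)) j c = N P j c" if "j < s" for j
    using state_move[OF c that] N_upd by auto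
  have X: "x \<in> N P (P x) c" "x \<noteq> c" "\<not> low x \<or> r (P x) < 2" if x: "x \<in> X" for x
  proof -
    show xc: "x \<noteq> c" using x by (auto simp: X_def K_def)
    then show xN: "x \<in> N P (P x) c" using x by (auto simp: X_def K_def nb_def N_def)
    show "\<not> low x \<or> r (P x) < 2"
    proof (rule ccontr)
      assume no: "\<not> ?thesis"
      have "P x < s" using x KV XK Ps by blast
      then have "insert x (nb x) = K"
        unfolding K_def using low_twins[of "P(c := P x)" c x] moved[of "P x"] c xN no by simp
      then show False using x by (simp add: X_def)
    qed
  qed
  \<comment> \<open>Capacity 1 leaves room for only one neighbour of \<open>c\<close>. Otherwise
    both vertices are high, yet adjacent by \<open>clique_component\<close>.\<close>
  have inj: "inj_on P X"
  proof (rule inj_onI, rule ccontr)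
    fix x y assume xy: "x \<in> X" "y \<in> X" "P x = P y" "x \<noteq> y"
    let ?j = "P x"
    have j: "?j < s" using xy KV XK Ps by blast
    have xyN: "x \<in> N P ?j c" "y \<in> N P ?j c" using X(1)[of x] X(1)[of y] xy by auto
    show False
    proof (cases "r ?j < 2")
      case True
      have "card {x, y} \<le> card (N P ?j c)"
        using xyN finite_N by (intro card_mono) auto
      then show False using True low_card_N[OF c j] xy(4) by simp
    next
      case False
      then have high: "\<not> low x" "\<not> low y" using X(3)[of x] X(3)[of y] xy by auto
      have "E x y"
      proof (cases "?j = ?i")
        case True
        obtain l where l: "l < s" "l \<noteq> ?i"
          using ex_other_part by blast
        obtain u where "low u" "P u = l" "N P ?i c \<subseteq> nb u"
          using ex_return[OF c l] by blast
        then show ?thesis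
          using clique_component(1)[OF c r d, of u x y] l xyN True xy(4) by auto
      next
        case ji: False
        obtain u where u: "low u" "P u = ?j" "N P ?i c \<subseteq> nb u"
          using ex_return[OF c j ji] by blast
        then have "c \<in> nb u"
          using twins_in_part(2)[OF c(1) r d, of u] ji by simp
        then have uN: "u \<in> N P ?j c" using u(2) edge_sym by (auto simp: N_def nb_def)
        let ?P = "P(c := ?j)"
        have "?i \<noteq> ?P c" using ji by simp
        then obtain v where v: "low v" "?P v = ?i" "N ?P (?P c) c \<subseteq> nb v"
          using ex_return[OF moved(1)[OF j] c(2) si] by blast
        then show ?thesis
          using clique_component(1)[OF moved(1)[OF j] c(2) _ _ u(1) v(1) _ v(3), of x y]
            moved(2)[OF j] uN xyN xy(4) False ji by auto
      qed
      then show False using high_indep[of x y] high by (auto simp: low_def)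
    qed
  qed
  have "P ` X \<subseteq> {..<s}" using Ps KV XK by blast
  then have Xs: "card X \<le> s" using card_inj_on_le[OF inj, of "{..<s}"] by simp
  have "card X \<le> 1"
  proof (rule ccontr)
    assume X2: "\<not> ?thesis"
    \<comment> \<open>Without high vertices, \<open>X\<close> lies in parts of capacity 1, hence in
      part \<open>0\<close>.\<close>
    have high: "\<exists>v. \<not> low v"
    proof (rule ccontr)
      assume "\<not> ?thesis"
      then have "r (P x) < 2" "P x < s" if "x \<in> X" for x
        using X(3)[OF that] Ps KV XK that by auto
      then have "P ` X \<subseteq> {0}" using r_pos by fastforce
      then have "card X \<le> card {0::nat}" by (intro card_inj_on_le[OF inj]) auto
      then show False using X2 by simp
    qed
    then have "2 \<le> r 0" using high_r_0 by (auto simp: low_def not_le)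
    then have "2 \<le> r j" if "j < s" for j using r_pos that by (cases "j = 0") auto
    then have Xhigh: "\<not> low x" if "x \<in> X" for x
      using X(3)[OF that] that Ps KV XK by (metis not_le subsetD)
    have h: "2 \<le> card X" using X2 by simp
    have t5: "5 * (s - 1) \<le> t" using few high by blast
    have "colourable E V t"
    \<comment> \<open>A vertex of \<open>X\<close> has degree at most \<open>t + s - 1\<close> and
      is adjacent to all \<open>t + 1 - card X\<close> vertices of \<open>K - X\<close>; the
      difference is \<open>m\<close>.\<close>
    proof (rule colourable_merge[OF finite_V KV cardK XK, where m = "s - 2 + card X"])
      show "\<not> E x y" if "x \<in> X" "y \<in> X" for x y
        using high_indep[of x y] Xhigh that by (auto simp: low_def)
      show "v \<in> K" if "w \<in> K - X" "v \<in> V" "E w v" for w v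
        using that by (auto simp: X_def nb_def)
      show "card {v. E x v \<and> v \<in> V - K} \<le> s - 2 + card X" if x: "x \<in> X" for x
      proof -
        have sub: "K - X \<subseteq> nb x"
        proof
          fix z assume z: "z \<in> K - X"
          then have "x \<in> insert z (nb z)" using x by (auto simp: X_def)
          then show "z \<in> nb x" using z x edge_sym by (auto simp: nb_def)
        qed
        have "{v. E x v \<and> v \<in> V - K} \<subseteq> nb x - (K - X)" by (auto simp: nb_def)
        then have "card {v. E x v \<and> v \<in> V - K} \<le> card (nb x - (K - X))"
          by (intro card_mono) (auto simp: finite_nb)
        also have "\<dots> = card (nb x) - card (K - X)"
          using card_Diff_subset[OF finite_subset[OF sub finite_nb] sub] .
        also have "card (K - X) = t + 1 - card X"
          using card_Diff_subset[OF finX XK] cardK by simp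
        finally show ?thesis using nb_bound[of x] h two_parts by linarith
      qed
      \<comment> \<open>Here the factor 5/6 matters: \<open>card X \<le> s\<close> and
        \<open>5 * (s - 1) \<le> t\<close> make any two lists together longer than
        \<open>t\<close>.\<close>
      obtain a where a: "card X = 2 + a" using h le_Suc_ex by blast
      obtain b where b: "s = 2 + a + b" using Xs a le_Suc_ex by metis
      have "5 * (1 + a + b) \<le> t" using t5 b by simp
      then obtain e where e: "t = 5 * (1 + a + b) + e" using le_Suc_ex by blast
      have m: "t - (s - 2 + card X) = 3 + 3 * a + 4 * b + e" using a b e by simp
      have "t < 2 * (3 + 3 * a + 4 * b + e)" using e by simp
      also have "\<dots> \<le> card X * (3 + 3 * a + 4 * b + e)" using a by simp
      finally show "t < card X * (t - (s - 2 + card X))" unfolding m .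
      show "colourable E (V - K) t"
        using colourable_mono[OF critical[OF cV]] by (auto simp: K_def)
    qed
    then show False using not_colourable by blast
  qed
  then have one: "x = y" if "x \<in> X" "y \<in> X" for x y
    using that finX card_le_Suc0_iff_eq by (metis One_nat_def)
  have "E x y" if xy: "x \<in> K" "y \<in> K" "x \<noteq> y" for x y
  proof -
    have "insert x (nb x) = K \<or> insert y (nb y) = K"
      using one[of x y] xy by (auto simp: X_def)
    then have "y \<in> insert x (nb x) \<or> x \<in> insert y (nb y)" using xy by blast
    then show ?thesis using xy edge_sym by (auto simp: nb_def)
  qed
  then show ?thesis using KV cardK by blast
qed

end

section \<open>Choice of capacities and reduction to a critical subgraph\<close>

lemma ex_critical_subset:
  assumes "finite V" "\<not> colourable E V t"
  obtains U where "U \<subseteq> V" "\<not> colourable E U t" "\<And>v. v \<in> U \<Longrightarrow> colourable E (U - {v}) t"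
proof -
  obtain U where U: "U \<subseteq> V" "\<not> colourable E U t"
    and min: "\<And>W. W \<subseteq> V \<Longrightarrow> \<not> colourable E W t \<Longrightarrow> card U \<le> card W"
    using ex_has_least_nat[of "\<lambda>U. U \<subseteq> V \<and> \<not> colourable E U t" V card] assms by blast
  have "colourable E (U - {v}) t" if "v \<in> U" for v
  proof (rule ccontr)
    assume "\<not> ?thesis"
    then have "card U \<le> card (U - {v})" using U by (intro min) auto
    then show False
      using card_Diff1_less[of U v] that finite_subset[OF U(1) assms(1)] by simp
  qed
  with U that show thesis by blast
qed

lemma critical_clique:
  fixes V :: "'a set" and E :: "'a \<Rightarrow> 'a \<Rightarrow> bool"
  assumes simple: "simple_graph V E" and "3 \<le> t"
    and nc: "\<not> colourable E V t" and crit: "\<And>v. v \<in> V \<Longrightarrow> colourable E (V - {v}) t"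
    and high_indep: "\<And>u v. E u v \<Longrightarrow> degree V E u \<le> t \<or> degree V E v \<le> t"
    and deg: "\<And>v. v \<in> V \<Longrightarrow> 5 * degree V E v \<le> 6 * t"
  shows "\<exists>K. is_clique V E K \<and> card K = t + 1"
proof -
  interpret graph V E by unfold_locales (rule simple)
  have nb: "card (nb v) = degree V E v" for v
    using edge_in by (auto simp: nb_def degree_def intro: arg_cong[of _ _ card])
  have nbV: "card (nb v) = 0" if "v \<notin> V" for v
  proof -
    have "nb v = {}" using edge_in that by (auto simp: nb_def)
    then show ?thesis by simp
  qed
  have "\<exists>K \<subseteq> V. card K = t + 1 \<and> (\<forall>x\<in>K. \<forall>y\<in>K. x \<noteq> y \<longrightarrow> E x y)"
  proof (cases "\<exists>v. t < card (nb v)")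
    case False
    \<comment> \<open>All degrees are at most \<open>t\<close>, so two parts suffice;
      \<open>3 \<le> t\<close> gives part \<open>1\<close> capacity at least 2.\<close>
    define r :: "nat \<Rightarrow> nat" where "r i = (if i = 0 then 1 else t - 1)" for i
    interpret critical_graph V E t 2 r
    proof unfold_locales
      show "card (nb v) < t + 2" for v using False by (meson less_add_same_cancel1 linorder_not_le le_less_trans zero_less_numeral)
      show "2 \<le> r 0" if "t < card (nb v)" for v using False that by blast
      show "card (nb u) \<le> t \<or> card (nb v) \<le> t" for u v using False not_less by blast
      show "(\<Sum>i<2. r i) = t" using \<open>3 \<le> t\<close> by (simp add: r_def numeral_2_eq_2)
    qed (use nc crit \<open>3 \<le> t\<close> in \<open>auto simp: r_def\<close>)
    show ?thesis using ex_clique False by (auto simp: low_def not_le)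
  next
    case True
    \<comment> \<open>The largest excess of a degree over \<open>t\<close> that \<open>deg\<close>
      allows, that is \<open>t div 5\<close>. Hence \<open>p + 1\<close> parts satisfy
      \<open>nb_bound\<close>.\<close>
    define p where "p = 6 * t div 5 - t"
    have bound: "card (nb v) \<le> t + p" for v
    proof (cases "v \<in> V")
      case True
      then show ?thesis using deg[OF True] nb[of v] unfolding p_def by linarith
    qed (simp add: nbV)
    have p5: "5 * p \<le> t" unfolding p_def by linarith
    have p1: "1 \<le> p" using True bound by (cases p) (auto simp: not_less[symmetric])
    \<comment> \<open>Part \<open>0\<close> takes the colours left over by \<open>p\<close> parts of
      capacity 2, at least \<open>3 * p\<close> of them.\<close>
    define r :: "nat \<Rightarrow> nat" where "r i = (if i = 0 then t - 2 * p else 2)" for i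
    have r0: "2 \<le> r 0" using p5 p1 by (simp add: r_def)
    interpret critical_graph V E t "p + 1" r
    proof unfold_locales
      have "(\<Sum>i<p + 1. r i) = r 0 + (\<Sum>i<p. r (Suc i))"
        by (simp add: sum.lessThan_Suc_shift del: sum.lessThan_Suc)
      then show "(\<Sum>i<p + 1. r i) = t" using p5 by (simp add: r_def)
      show "card (nb v) < t + (p + 1)" for v using bound[of v] by simp
      show "card (nb u) \<le> t \<or> card (nb v) \<le> t" if "E u v" for u v
        using high_indep[OF that] nb by simp
    qed (use nc crit p1 r0 in \<open>auto simp: r_def\<close>)
    show ?thesis using ex_clique p5 by simp
  qed
  then show ?thesis unfolding is_clique_def by blast
qed

lemma degree_le_max_degree:
  assumes "finite V" "v \<in> V"
  shows "degree V E v \<le> max_degree V E"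
  using assms by (auto simp: max_degree_def)

lemma degree_le_delta2:
  assumes "finite V" "u \<in> V" "v \<in> V" "E u v" "degree V E u \<le> degree V E v"
  shows "degree V E u \<le> delta2 V E"
  unfolding delta2_def using assms by (intro Max_ge) auto

lemma card_clique_le:
  assumes "finite V" "is_clique V E K"
  shows "card K \<le> clique_number V E"
  unfolding clique_number_def
proof (rule Max_ge)
  have "{card K | K. is_clique V E K} \<subseteq> card ` Pow V" by (auto simp: is_clique_def)
  then show "finite {card K | K. is_clique V E K}" using assms(1) finite_subset by blast
qed (use assms in blast)

theorem mainTheorem1:
  fixes V :: "'a set" and E :: "'a \<Rightarrow> 'a \<Rightarrow> bool"
  assumes "simple_graph V E"
    and "max_degree V E \<ge> 3"
  shows "real (chromatic_number V E)
           \<le> max (real (clique_number V E))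
                  (max (real (delta2 V E)) (5 / 6 * (real (max_degree V E) + 1)))"
proof (rule ccontr)
  assume "\<not> ?thesis"
  then have lt: "clique_number V E < chromatic_number V E" "delta2 V E < chromatic_number V E"
    "5 * (max_degree V E + 1) < 6 * chromatic_number V E"
    by (auto simp: not_le)
  then obtain t where t: "chromatic_number V E = t + 1"
    by (metis Suc_eq_plus1 less_imp_Suc_add)
  \<comment> \<open>From \<open>20 \<le> 5 * (max_degree V E + 1) < 6 * (t + 1)\<close>.\<close>
  have t3: "3 \<le> t" using lt(3) assms(2) t by simp
  interpret graph V E by unfold_locales (rule assms(1))
  have "\<not> colourable E V t"
    unfolding colourable_def using not_less_Least[of t "\<lambda>k. \<exists>c. proper_colouring V E k c"] t
    by (simp add: chromatic_number_def)
  then obtain U where U: "U \<subseteq> V" "\<not> colourable E U t"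
    and crit: "\<And>v. v \<in> U \<Longrightarrow> colourable E (U - {v}) t"
    using ex_critical_subset[OF finite_V] by metis
  \<comment> \<open>\<open>simple_graph\<close> demands that edges end in the vertex set, so they
    are restricted to \<open>U\<close>.\<close>
  define F where "F u v \<longleftrightarrow> E u v \<and> u \<in> U \<and> v \<in> U" for u v
  have col: "colourable F X n \<longleftrightarrow> colourable E X n" if "X \<subseteq> U" for X n
    using that unfolding colourable_def proper_colouring_def F_def by (meson subsetD)
  have finU: "finite U" using U(1) finite_V finite_subset by blast
  have deg: "degree U F v \<le> degree V E v" for v
    unfolding degree_def using U(1) finite_V by (intro card_mono) (auto simp: F_def)
  have "\<exists>K. is_clique U F K \<and> card K = t + 1"
  proof (rule critical_clique)
    show "simple_graph U F"
      using finU edge_sym edge_irrefl by (auto simp: simple_graph_def F_def)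
    show "\<not> colourable F U t" using U(2) col by simp
    show "colourable F (U - {v}) t" if "v \<in> U" for v using crit[OF that] col by simp
    show "5 * degree U F v \<le> 6 * t" if "v \<in> U" for v
    proof -
      have "degree U F v \<le> max_degree V E"
        using deg[of v] degree_le_max_degree[OF finite_V, of v E] that U(1) by (meson le_trans subsetD)
      moreover have "5 * max_degree V E \<le> 6 * t" using lt(3) t by simp
      ultimately show ?thesis by simp
    qed
    show "degree U F u \<le> t \<or> degree U F v \<le> t" if "F u v" for u v
    proof (rule ccontr)
      assume "\<not> ?thesis"
      \<comment> \<open>The end of smaller degree is counted by \<open>delta2\<close>, which is at
        most \<open>t\<close>.\<close>
      then have "t < degree V E u" "t < degree V E v" using deg[of u] deg[of v] by auto
      moreover have "E u v" "u \<in> V" "v \<in> V" using that U(1) by (auto simp: F_def)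
      ultimately show False
        using degree_le_delta2[OF finite_V, of u v E] degree_le_delta2[OF finite_V, of v u E]
          edge_sym lt(2) t by (cases "degree V E u \<le> degree V E v") auto
    qed
  qed (rule t3)
  then obtain K where K: "is_clique U F K" "card K = t + 1" by blast
  then have "is_clique V E K" using U(1) by (auto simp: is_clique_def F_def)
  then show False using card_clique_le[OF finite_V] K(2) lt(1) t by fastforce
qed

end
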